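(* Let $S\in\mathbb{R}^{3\times3}$ be skew-symmetric, and suppose that the potentials satisfy the invariance properties $$U(e^{\tau S}x)=U(x),\qquad e^{-\tau S}A(e^{\tau S}x)=A(x)\qquad\text{for all }\tau\in\mathbb{R}.$$ Assume moreover that both of the following hold: (a) the magnetic field is constant, $B(x)\equiv B$, and $Sv=v\times B$ for all $v\in\mathbb{R}^3$; (b) $U(x)=\frac12x^\intercal Qx+q^\intercal x$ with a symmetric matrix $Q\in\mathbb{R}^{3\times3}$ and $q\in\mathbb{R}^3$, and $QS=SQ$. Let $(x^n,v^n)_{n\ge0}$ be the numerical solution with step size $h>0$ of either of the methods IMS-O2 or EXS-O2 applied to $\ddot x=\dot x\times B(x)-\nabla U(x)$, $x(0)=x_0$, $\dot x(0)=v_0$. Then, for an arbitrarily large positive integer $N$, the momentum $M(x,v)=(v+A(x))^\intercal Sx$ satisfies $$M(x^n,v^n)=M(x^0,v^0)+\mathcal{O}(h^2)\qquad\text{for } nh\le h^{2-N}.$$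
   Context: Setting: $x(t)\in\mathbb{R}^3$, $v=\dot x\in\mathbb{R}^3$, $B=\nabla\times A$ is a magnetic field with vector potential $A:\mathbb{R}^3\to\mathbb{R}^3$, $U:\mathbb{R}^3\to\mathbb{R}$ is a scalar potential, $E(x)=-\nabla U(x)$. For constant $B$ and $Sv=v\times B$ one takes $A(x)=-\frac12x\times B$, so that $M(x,v)=v^\intercal(x\times B)-\frac12|x\times B|^2$. $\tilde B(x)\in\mathbb{R}^{3\times3}$ is the skew-symmetric matrix with $\tilde B(x)v=v\times B(x)$ for all $v$. Both methods start from $x^0=x_0$, $v^0=v_0$. Method IMS-O2 (implicit): for $n\ge0$, $$x^{n+1}=x^n+he^{\frac h2\tilde B(x^n)}v^n+\frac{h^2}{2}\int_0^1E(\rho x^n+(1-\rho)x^{n+1})\,d\rho,$$ $$v^{n+1}=e^{\frac h2\tilde B(x^{n+1})}e^{\frac h2\tilde B(x^n)}v^n+he^{\frac h2\tilde B(x^{n+1})}\int_0^1E(\rho x^n+(1-\rho)x^{n+1})\,d\rho.$$ Method EXS-O2 (explicit): for $n\ge0$, $$x^{n+1}=x^n+he^{\frac h2\tilde B(x^n)}v^n+\frac{h^2}{2}E(x^n),$$ $$v^{n+1}=e^{\frac h2\tilde B(x^{n+1})}e^{\frac h2\tilde B(x^n)}v^n+\frac h2e^{\frac h2\tilde B(x^{n+1})}\left[E(x^n)+E(x^{n+1})\right].$$ Standing assumptions: $U$ and $B$ are arbitrarily differentiable, and there is a compact set, independent of $h$, in which the numerical solution $(x^n,v^n)$ stays. The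 constant symbolized by $\mathcal{O}$ is independent of $n$ and $h$ (it may depend on $N$), as $h\to0$. *)

theory Defs
  imports "HOL-Analysis.Analysis"
begin

(* The matrix types carry no algebra structure for the matrix product (the class
   multiplication on vectors is componentwise), so the library's exp does not apply.
   The series converges in the Euclidean norm of real^'n^'n. *)
definition mexp :: "real^'n^'n \<Rightarrow> real^'n^'n"
  where "mexp M = (\<Sum>k. (1 / fact k) *\<^sub>R (((**) M ^^ k) (mat 1)))"

(* Meaningful at points of differentiability only; likewise curl below. *)
definition grad :: "(real^'n \<Rightarrow> real) \<Rightarrow> real^'n \<Rightarrow> real^'n"
  where "grad U x = (\<chi> i. frechet_derivative U (at x) (axis i 1))"

(* jacobian A (at x) $ i $ j is the partial derivative of the i-th component of A
   in the j-th coordinate direction. *)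
definition curl :: "(real^3 \<Rightarrow> real^3) \<Rightarrow> real^3 \<Rightarrow> real^3"
  where "curl A x =
    (let J = jacobian A (at x) in
     vector [J $ 3 $ 2 - J $ 2 $ 3, J $ 1 $ 3 - J $ 3 $ 1, J $ 2 $ 1 - J $ 1 $ 2])"

definition vector_potential :: "(real^3 \<Rightarrow> real^3) \<Rightarrow> (real^3 \<Rightarrow> real^3) \<Rightarrow> bool"
  where "vector_potential A B \<longleftrightarrow> (\<forall>x. A differentiable (at x) \<and> curl A x = B x)"

definition Btilde :: "(real^3 \<Rightarrow> real^3) \<Rightarrow> real^3 \<Rightarrow> real^3^3"
  where "Btilde B x = matrix (\<lambda>v. cross3 v (B x))"

definition efield :: "(real^3 \<Rightarrow> real) \<Rightarrow> real^3 \<Rightarrow> real^3"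
  where "efield U x = - grad U x"

definition momentum :: "real^3^3 \<Rightarrow> (real^3 \<Rightarrow> real^3) \<Rightarrow> real^3 \<Rightarrow> real^3 \<Rightarrow> real"
  where "momentum S A x v = (v + A x) \<bullet> (S *v x)"

(* The two methods as relations between the data and the sequences of iterates. For the
   implicit method neither existence nor uniqueness of the iterates is presupposed. *)
definition ims_o2 ::
  "(real^3 \<Rightarrow> real^3) \<Rightarrow> (real^3 \<Rightarrow> real) \<Rightarrow> real \<Rightarrow> real^3 \<Rightarrow> real^3 \<Rightarrow>
    (nat \<Rightarrow> real^3) \<Rightarrow> (nat \<Rightarrow> real^3) \<Rightarrow> bool"
  where "ims_o2 B U h x0 v0 x v \<longleftrightarrow>
    x 0 = x0 \<and> v 0 = v0 \<and>
    (\<forall>n. let R = mexp ((h / 2) *\<^sub>R Btilde B (x n));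
             R' = mexp ((h / 2) *\<^sub>R Btilde B (x (Suc n)));
             F = integral {0..1} (\<lambda>\<rho>. efield U (\<rho> *\<^sub>R x n + (1 - \<rho>) *\<^sub>R x (Suc n)))
         in x (Suc n) = x n + h *\<^sub>R (R *v v n) + (h\<^sup>2 / 2) *\<^sub>R F \<and>
            v (Suc n) = R' *v (R *v v n) + h *\<^sub>R (R' *v F))"

definition exs_o2 ::
  "(real^3 \<Rightarrow> real^3) \<Rightarrow> (real^3 \<Rightarrow> real) \<Rightarrow> real \<Rightarrow> real^3 \<Rightarrow> real^3 \<Rightarrow>
    (nat \<Rightarrow> real^3) \<Rightarrow> (nat \<Rightarrow> real^3) \<Rightarrow> bool"
  where "exs_o2 B U h x0 v0 x v \<longleftrightarrow>
    x 0 = x0 \<and> v 0 = v0 \<and>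
    (\<forall>n. let R = mexp ((h / 2) *\<^sub>R Btilde B (x n));
             R' = mexp ((h / 2) *\<^sub>R Btilde B (x (Suc n)))
         in x (Suc n) = x n + h *\<^sub>R (R *v v n) + (h\<^sup>2 / 2) *\<^sub>R efield U (x n) \<and>
            v (Suc n) = R' *v (R *v v n)
              + (h / 2) *\<^sub>R (R' *v (efield U (x n) + efield U (x (Suc n)))))"

end

theory Submission
  imports Defs
begin

text \<open>
  Let \<open>b \<noteq> 0\<close>; otherwise \<open>S = 0\<close> and \<open>M\<close> vanishes. Write \<open>\<beta> = |b|\<close>, \<open>\<theta> = h \<beta> / 2\<close> and \<open>R = exp ((h / 2) S)\<close>. Each of the two methods conserves
  exactly a modified momentum that differs from \<open>M\<close> by \<open>O(h\<^sup>2)\<close> on compact sets, so the error in \<open>M\<close>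
  cannot accumulate with \<open>n\<close>.

  The momentum itself is explicit. Invariance of \<open>A\<close> under the rotations, differentiated at the
  identity, combines with \<open>curl A = b\<close> to show that \<open>A x \<bullet> S x + |S x|\<^sup>2 / 2\<close> has zero derivative;
  it vanishes at the origin, so \<open>M(x, v) = v \<bullet> S x - |S x|\<^sup>2 / 2\<close>, whatever invariant gauge \<open>A\<close> is in
  (\<open>potential_along_rotation\<close>). Invariance of \<open>U\<close> makes its linear part orthogonal to the range of
  \<open>S\<close>, and \<open>Q S\<close> is skew, so the force \<open>E\<close> satisfies \<open>E(x) \<bullet> S x = 0\<close>
  (\<open>invariant_quadratic_force_tangential\<close>).

  One step from \<open>(x, v)\<close> to \<open>(x', v')\<close> is a half rotation \<open>w = R v\<close>, a kick and drift from \<open>(x, w)\<close>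
  to \<open>(x', u)\<close>, and a half rotation \<open>v' = R u\<close>. As the force is tangential, the middle part conserves
  the angular momentum, \<open>u \<bullet> S x' = w \<bullet> S x\<close>, and it changes \<open>|S x|\<^sup>2\<close> by
  \<open>h (S w \<bullet> S x + S u \<bullet> S x')\<close> up to \<open>- h\<^sup>2 (g' - g)\<close>, where \<open>g\<close> is a function of the state alone:
  \<open>|S v|\<^sup>2 / 4\<close> for the implicit and \<open>S E(x) \<bullet> S x / 2\<close> for the explicit method. In this difference
  the half rotations can be eliminated through the Rodrigues formula: multiplied by \<open>sin \<theta>\<close>,
  the bracket is \<open>\<beta> (v' \<bullet> S x' - v \<bullet> S x)\<close> (\<open>rotated_step\<close>). Hence
  \<open>2 \<theta> (v \<bullet> S x) - sin \<theta> (|S x|\<^sup>2 + h\<^sup>2 g)\<close> is the same at every step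
  (\<open>modified_momentum_conserved\<close>). As \<open>\<theta> = (1 + O(\<theta>\<^sup>2)) sin \<theta>\<close>, dividing by \<open>2 sin \<theta>\<close> gives
  \<open>M\<close> up to \<open>O(h\<^sup>2)\<close> (\<open>momentum_drift_bound\<close>).
\<close>

section \<open>Skew matrices and the Rodrigues formula\<close>

lemma inner_skew_matrix: fixes S :: "real^'n^'n" assumes "transpose S = - S"
  shows "(S *v x) \<bullet> y = - (x \<bullet> (S *v y))"
proof -
  have "(S *v x) \<bullet> y = x \<bullet> (transpose S *v y)"
    by (metis dot_lmul_matrix vector_transpose_matrix transpose_transpose)
  also have "transpose S *v y = - (S *v y)"
    unfolding assms using scaleR_matrix_vector_assoc[of "-1" S y] by simp
  finally show ?thesis by simp
qed

lemma matrix_power_scaleR: fixes S :: "real^'n^'n"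
  shows "((**) (t *\<^sub>R S) ^^ k) (mat 1) = t ^ k *\<^sub>R ((**) S ^^ k) (mat 1)"
  by (induction k) (simp_all add: matrix_scalar_ac mult.commute flip: scalar_matrix_assoc)

lemma power2_power_swap: "(x ^ j)\<^sup>2 = (x\<^sup>2) ^ j" for x :: real
  by (metis power_mult mult.commute)

text \<open>
  The hypothesis on \<open>S ** S ** S\<close> reduces every positive power of \<open>S\<close> to a multiple of \<open>S\<close> or
  \<open>S ** S\<close>, and the coefficients are those of the sine and cosine series. Only the identity
  matrix, the power of order 0, does not fit the pattern.
\<close>
lemma mexp_rodrigues:
  fixes S :: "real^'n^'n"
  assumes cube: "S ** S ** S = - (\<beta>\<^sup>2) *\<^sub>R S" and \<beta>: "\<beta> \<noteq> 0"
  shows "mexp (t *\<^sub>R S) = mat 1 + (sin (\<beta> * t) / \<beta>) *\<^sub>R S + ((1 - cos (\<beta> * t)) / \<beta>\<^sup>2) *\<^sub>R (S ** S)"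
proof -
  have odd_pow: "((**) S ^^ (2 * j + 1)) (mat 1) = (- (\<beta>\<^sup>2)) ^ j *\<^sub>R S" for j
  proof (induction j)
    case (Suc j)
    have "((**) S ^^ (2 * Suc j + 1)) (mat 1) = S ** (S ** ((**) S ^^ (2 * j + 1)) (mat 1))"
      by simp
    also have "\<dots> = (- (\<beta>\<^sup>2)) ^ j *\<^sub>R (S ** S ** S)"
      unfolding Suc by (simp add: matrix_scalar_ac matrix_mul_assoc flip: scalar_matrix_assoc)
    finally show ?case by (simp add: cube)
  qed simp
  \<comment> \<open>The extra summand at \<open>k = 0\<close> supplies the identity matrix and cancels the cosine coefficient there.\<close>
  have coeffs: "(1 / fact k) *\<^sub>R ((**) (t *\<^sub>R S) ^^ k) (mat 1) =
      (if k = 0 then mat 1 + (1 / \<beta>\<^sup>2) *\<^sub>R (S ** S) else 0)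
      + (sin_coeff k *\<^sub>R (\<beta> * t) ^ k / \<beta>) *\<^sub>R S
      - (cos_coeff k *\<^sub>R (\<beta> * t) ^ k / \<beta>\<^sup>2) *\<^sub>R (S ** S)" for k
  proof (cases "even k")
    case False
    then obtain j where k: "k = 2 * j + 1" by (elim oddE)
    have "(1 / fact k) *\<^sub>R ((**) (t *\<^sub>R S) ^^ k) (mat 1) = (t ^ k / fact k * (- (\<beta>\<^sup>2)) ^ j) *\<^sub>R S"
      unfolding matrix_power_scaleR by (simp only: k odd_pow) simp
    moreover have "sin_coeff k * (\<beta> * t) ^ k / \<beta> = t ^ k / fact k * (- (\<beta>\<^sup>2)) ^ j"
      using \<beta> by (simp add: k sin_coeff_def power_mult_distrib power_mult power_minus' mult_ac power_minus[of "\<beta>\<^sup>2"] power2_power_swap)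
    ultimately show ?thesis by (simp add: k cos_coeff_def)
  next
    case True
    show ?thesis
    proof (cases "k = 0")
      case False
      then obtain j where k: "k = Suc (2 * j + 1)" using True
        by (metis evenE add.commute Suc_eq_plus1 mult_Suc_right old.nat.exhaust add_2_eq_Suc mult_0_right)
      have "((**) S ^^ k) (mat 1) = (- (\<beta>\<^sup>2)) ^ j *\<^sub>R (S ** S)"
        unfolding k funpow.simps o_def odd_pow by (simp add: matrix_scalar_ac flip: scalar_matrix_assoc)
      then have "(1 / fact k) *\<^sub>R ((**) (t *\<^sub>R S) ^^ k) (mat 1) = (t ^ k / fact k * (- (\<beta>\<^sup>2)) ^ j) *\<^sub>R (S ** S)"
        unfolding matrix_power_scaleR by simp
      moreover have "cos_coeff k * (\<beta> * t) ^ k / \<beta>\<^sup>2 = - (t ^ k / fact k * (- (\<beta>\<^sup>2)) ^ j)"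
        using \<beta> by (simp add: k cos_coeff_def power_mult_distrib power_mult mult_ac power_minus[of "\<beta>\<^sup>2"] power2_power_swap)
          (simp add: power2_eq_square)
      ultimately show ?thesis using k True by (simp add: sin_coeff_def)
    qed (simp add: sin_coeff_def cos_coeff_def)
  qed
  have "(\<lambda>k. (1 / fact k) *\<^sub>R ((**) (t *\<^sub>R S) ^^ k) (mat 1)) sums
      ((mat 1 + (1 / \<beta>\<^sup>2) *\<^sub>R (S ** S)) + (sin (\<beta> * t) / \<beta>) *\<^sub>R S - (cos (\<beta> * t) / \<beta>\<^sup>2) *\<^sub>R (S ** S))"
    unfolding coeffs
    by (intro sums_diff sums_add sums_scaleR_left sums_divide sin_converges cos_converges sums_single)
  then show ?thesis
    by (simp add: mexp_def sums_iff diff_divide_distrib scaleR_left_diff_distrib)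
qed

lemma mexp_mult_vec:
  fixes S :: "real^'n^'n"
  assumes "S ** S ** S = - (\<beta>\<^sup>2) *\<^sub>R S" and "\<beta> \<noteq> 0"
  shows "mexp (t *\<^sub>R S) *v y = y + (sin (\<beta> * t) / \<beta>) *\<^sub>R (S *v y)
    + ((1 - cos (\<beta> * t)) / \<beta>\<^sup>2) *\<^sub>R (S *v (S *v y))"
  by (simp add: mexp_rodrigues[OF assms] matrix_vector_mult_add_rdistrib matrix_vector_mul_assoc
      flip: scaleR_matrix_vector_assoc)

lemma cube_vec:
  fixes S :: "real^'n^'n"
  assumes "S ** S ** S = - (\<beta>\<^sup>2) *\<^sub>R S"
  shows "S *v (S *v (S *v y)) = - (\<beta>\<^sup>2) *\<^sub>R (S *v y)"
  using assms by (metis matrix_vector_mul_assoc scaleR_matrix_vector_assoc)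

text \<open>
  On the range of \<open>S\<close> the matrix \<open>S / \<beta>\<close> squares to \<open>- 1\<close>, so the exponential acts there as
  \<open>cos (\<beta> t) + sin (\<beta> t) S / \<beta>\<close>.
\<close>
lemma S_mult_mexp:
  fixes S :: "real^'n^'n"
  assumes "S ** S ** S = - (\<beta>\<^sup>2) *\<^sub>R S" and "\<beta> \<noteq> 0"
  shows "S *v (mexp (t *\<^sub>R S) *v y) = cos (\<beta> * t) *\<^sub>R (S *v y) + (sin (\<beta> * t) / \<beta>) *\<^sub>R (S *v (S *v y))"
proof -
  have "S *v (S *v (S *v y)) = - (\<beta>\<^sup>2) *\<^sub>R (S *v y)"
    by (rule cube_vec[OF assms(1)])
  moreover have "(1 - cos (\<beta> * t)) / \<beta>\<^sup>2 * \<beta>\<^sup>2 = 1 - cos (\<beta> * t)"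
    using assms(2) by simp
  ultimately show ?thesis
    by (simp add: mexp_mult_vec[OF assms] matrix_vector_right_distrib matrix_vector_mult_scaleR
        scaleR_left_diff_distrib del: times_divide_eq_left)
qed

text \<open>
  The rotation of \<open>S_mult_mexp\<close> is inverted by changing the sign of the angle. This expresses the
  velocity before the second half rotation of a step through the velocity after it.
\<close>
lemma S_mult_mexp_preimage:
  fixes S :: "real^'n^'n"
  assumes cube: "S ** S ** S = - (\<beta>\<^sup>2) *\<^sub>R S" and \<beta>: "\<beta> \<noteq> 0" and v: "v = mexp (t *\<^sub>R S) *v u"
  shows "S *v u = cos (\<beta> * t) *\<^sub>R (S *v v) - (sin (\<beta> * t) / \<beta>) *\<^sub>R (S *v (S *v v))"
proof -
  let ?c = "cos (\<beta> * t)" and ?s = "sin (\<beta> * t)"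
  have S3: "S *v (S *v (S *v u)) = - (\<beta>\<^sup>2) *\<^sub>R (S *v u)"
    by (rule cube_vec[OF cube])
  have Sv: "S *v v = ?c *\<^sub>R (S *v u) + (?s / \<beta>) *\<^sub>R (S *v (S *v u))"
    unfolding v by (rule S_mult_mexp[OF cube \<beta>])
  have SSv: "S *v (S *v v) = ?c *\<^sub>R (S *v (S *v u)) - (?s * \<beta>) *\<^sub>R (S *v u)"
    unfolding Sv matrix_vector_right_distrib matrix_vector_mult_scaleR S3
    using \<beta> by (simp add: power2_eq_square)
  have "?c *\<^sub>R (S *v v) - (?s / \<beta>) *\<^sub>R (S *v (S *v v)) = (?c * ?c + ?s * ?s) *\<^sub>R (S *v u)"
    unfolding SSv unfolding Sv using \<beta>
    by (simp only: scaleR_right_distrib scaleR_right_diff_distrib scaleR_left_distrib scaleR_scaleR)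
      (simp add: mult.commute)
  also have "?c * ?c + ?s * ?s = 1" using sin_cos_squared_add3 by (simp add: add.commute)
  finally show ?thesis by simp
qed

lemma norm_S_mult_mexp:
  fixes S :: "real^'n^'n"
  assumes skew: "transpose S = - S" and cube: "S ** S ** S = - (\<beta>\<^sup>2) *\<^sub>R S" and \<beta>: "\<beta> \<noteq> 0"
  shows "norm (S *v (mexp (t *\<^sub>R S) *v y)) = norm (S *v y)"
proof -
  note sk = inner_skew_matrix[OF skew]
  have S3: "S *v (S *v (S *v y)) = - (\<beta>\<^sup>2) *\<^sub>R (S *v y)"
    by (rule cube_vec[OF cube])
  obtain a b where a_def: "a = S *v y" and b_def: "b = S *v (S *v y)" by blast
  have ab: "a \<bullet> b = 0"
    using sk[of a a] by (simp add: a_def b_def inner_commute)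
  have bb: "b \<bullet> b = \<beta>\<^sup>2 * (a \<bullet> a)"
    using sk[of a b] S3 by (simp add: a_def b_def)
  have "(S *v (mexp (t *\<^sub>R S) *v y)) \<bullet> (S *v (mexp (t *\<^sub>R S) *v y))
      = (cos (\<beta> * t))\<^sup>2 * (a \<bullet> a) + (sin (\<beta> * t) / \<beta>)\<^sup>2 * (b \<bullet> b)"
    unfolding S_mult_mexp[OF cube \<beta>] b_def[symmetric]
    unfolding a_def[symmetric] using ab by (simp add: inner_add_left inner_add_right inner_commute[of b a] power2_eq_square)
  also have "\<dots> = ((cos (\<beta> * t))\<^sup>2 + (sin (\<beta> * t))\<^sup>2) * (a \<bullet> a)"
    unfolding bb using \<beta>
    by (simp add: power_divide distrib_right del: sin_cos_squared_add sin_cos_squared_add2)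
  also have "\<dots> = a \<bullet> a" by (simp only: sin_cos_squared_add2 mult_1)
  finally show ?thesis by (simp add: norm_eq_sqrt_inner a_def)
qed

section \<open>Invariant potentials\<close>

lemma grad_quadratic:
  fixes Q :: "real^'n^'n" and q :: "real^'n"
  assumes sym: "transpose Q = Q" and U: "\<And>x. U x = 1 / 2 * (x \<bullet> (Q *v x)) + q \<bullet> x"
  shows "grad U x = Q *v x + q"
proof -
  have symm: "y \<bullet> (Q *v z) = z \<bullet> (Q *v y)" for y z
    using sym by (metis dot_lmul_matrix vector_transpose_matrix inner_commute)
  have U': "U = (\<lambda>x. 1 / 2 * (x \<bullet> (Q *v x)) + q \<bullet> x)" using U by auto
  have "(U has_derivative (\<lambda>k. (Q *v x + q) \<bullet> k)) (at x)"
  proof -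
    have "(U has_derivative (\<lambda>k. 1 / 2 * (x \<bullet> (Q *v k) + k \<bullet> (Q *v x)) + q \<bullet> k)) (at x)"
      unfolding U'
      by (auto intro!: derivative_eq_intros bounded_linear.has_derivative[OF matrix_vector_mul_bounded_linear])
    moreover have "1 / 2 * (x \<bullet> (Q *v k) + k \<bullet> (Q *v x)) + q \<bullet> k = (Q *v x + q) \<bullet> k" for k
      unfolding symm[of x k] inner_add_left inner_commute[of "Q *v x" k] by simp
    ultimately show ?thesis by simp
  qed
  then have "frechet_derivative U (at x) = (\<lambda>k. (Q *v x + q) \<bullet> k)"
    by (rule frechet_derivative_at[symmetric])
  then show ?thesis by (simp add: grad_def inner_axis vec_eq_iff)
qed

text \<open>
  The linear part of \<open>U\<close> is its odd part, hence is invariant by itself. Comparing the rotations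
  by the angles \<open>\<pi> / 2\<close> and \<open>- \<pi> / 2\<close>, whose difference is \<open>(2 / \<beta>) S\<close>, isolates \<open>q \<bullet> S x\<close>.
\<close>
lemma invariant_quadratic_linear_part:
  fixes Q S :: "real^'n^'n" and q :: "real^'n"
  assumes cube: "S ** S ** S = - (\<beta>\<^sup>2) *\<^sub>R S" and \<beta>: "\<beta> \<noteq> 0"
    and inv: "\<And>\<tau> x. U (mexp (\<tau> *\<^sub>R S) *v x) = U x"
    and U: "\<And>x. U x = 1 / 2 * (x \<bullet> (Q *v x)) + q \<bullet> x"
  shows "q \<bullet> (S *v x) = 0"
proof -
  have neg: "M *v (- y) = - (M *v y)" for M :: "real^'n^'n" and y
    using matrix_vector_mult_scaleR[of M "-1" y] by simp
  have odd: "2 * (q \<bullet> y) = U y - U (- y)" for y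
    by (simp add: U neg)
  have q: "q \<bullet> (mexp (\<tau> *\<^sub>R S) *v x) = q \<bullet> x" for \<tau>
    using odd[of "mexp (\<tau> *\<^sub>R S) *v x"] odd[of x] inv[of \<tau> x] inv[of \<tau> "- x"] by (simp add: neg)
  show ?thesis
    using q[of "pi / (2 * \<beta>)"] q[of "- (pi / (2 * \<beta>))"] \<beta>
    unfolding mexp_mult_vec[OF cube \<beta>] by (simp add: inner_add_right inner_diff_right)
qed

text \<open>
  The quadratic part contributes \<open>x \<bullet> Q S x\<close>, which is zero because a product of commuting
  symmetric and skew matrices is skew.
\<close>
lemma invariant_quadratic_force_tangential:
  fixes Q S :: "real^'n^'n" and q :: "real^'n"
  assumes skew: "transpose S = - S" and cube: "S ** S ** S = - (\<beta>\<^sup>2) *\<^sub>R S" and \<beta>: "\<beta> \<noteq> 0"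
    and inv: "\<And>\<tau> x. U (mexp (\<tau> *\<^sub>R S) *v x) = U x"
    and U: "\<And>x. U x = 1 / 2 * (x \<bullet> (Q *v x)) + q \<bullet> x"
    and Q: "transpose Q = Q" and QS: "Q ** S = S ** Q"
  shows "grad U x \<bullet> (S *v x) = 0"
proof -
  have "(Q *v x) \<bullet> (S *v x) = x \<bullet> (Q *v (S *v x))"
    using Q by (metis dot_lmul_matrix vector_transpose_matrix)
  also have "\<dots> = x \<bullet> (S *v (Q *v x))"
    by (simp add: matrix_vector_mul_assoc QS)
  also have "\<dots> = - ((Q *v x) \<bullet> (S *v x))"
    using inner_skew_matrix[OF skew, of x "Q *v x"] by (simp add: inner_commute)
  finally have "(Q *v x) \<bullet> (S *v x) = 0" by simp
  moreover have "q \<bullet> (S *v x) = 0"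
    by (rule invariant_quadratic_linear_part[OF cube \<beta> inv U])
  ultimately show ?thesis
    by (simp add: grad_quadratic[OF Q U] inner_add_left)
qed

text \<open>
  The infinitesimal form of the equivariance of \<open>A\<close>: the assumption is differentiated at
  \<open>\<tau> = 0\<close>, with the exponentials written out by the Rodrigues formula.
\<close>
lemma equivariant_derivative:
  fixes S :: "real^'n^'n" and A :: "real^'n \<Rightarrow> real^'n"
  assumes cube: "S ** S ** S = - (\<beta>\<^sup>2) *\<^sub>R S" and \<beta>: "\<beta> \<noteq> 0"
    and A: "(A has_derivative A') (at x)"
    and inv: "\<And>\<tau>. mexp (- \<tau> *\<^sub>R S) *v A (mexp (\<tau> *\<^sub>R S) *v x) = A x"
  shows "A' (S *v x) = S *v A x"
proof -
  note bl = bounded_linear.has_vector_derivative[OF matrix_vector_mul_bounded_linear]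
  \<comment> \<open>the orbit of \<open>x\<close> under the rotations\<close>
  define c where "c \<tau> = x + (sin (\<beta> * \<tau>) / \<beta>) *\<^sub>R (S *v x)
    + ((1 - cos (\<beta> * \<tau>)) / \<beta>\<^sup>2) *\<^sub>R (S *v (S *v x))" for \<tau>
  have c0: "c 0 = x" by (simp add: c_def)
  have dc: "(c has_vector_derivative S *v x) (at 0)"
    unfolding c_def using \<beta> by (auto intro!: derivative_eq_intros)
  have dA: "((\<lambda>\<tau>. A (c \<tau>)) has_vector_derivative A' (S *v x)) (at 0)"
    using vector_derivative_diff_chain_within[of c "S *v x" 0 UNIV A A'] dc A
    by (auto simp: c0 o_def intro: has_derivative_at_withinI)
  have "((\<lambda>\<tau>. A (c \<tau>) + (sin (\<beta> * (- \<tau>)) / \<beta>) *\<^sub>R (S *v A (c \<tau>))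
      + ((1 - cos (\<beta> * (- \<tau>))) / \<beta>\<^sup>2) *\<^sub>R (S *v (S *v A (c \<tau>)))) has_vector_derivative
      A' (S *v x) - S *v A x) (at 0)"
    using \<beta> by (auto intro!: derivative_eq_intros dA bl simp: c0)
  moreover have "A (c \<tau>) + (sin (\<beta> * (- \<tau>)) / \<beta>) *\<^sub>R (S *v A (c \<tau>))
      + ((1 - cos (\<beta> * (- \<tau>))) / \<beta>\<^sup>2) *\<^sub>R (S *v (S *v A (c \<tau>))) = A x" for \<tau>
    using inv[of \<tau>] unfolding mexp_mult_vec[OF cube \<beta>] c_def .
  ultimately have "((\<lambda>\<tau>. A x) has_vector_derivative A' (S *v x) - S *v A x) (at 0)" by simp
  then show ?thesis
    using vector_derivative_unique_at[OF _ has_vector_derivative_const] by fastforce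
qed

text \<open>
  Turns the curl condition on \<open>A\<close> into a relation between the Jacobian and its transpose.
\<close>
lemma jacobian_curl:
  "(jacobian A (at x) - transpose (jacobian A (at x))) *v y = cross3 (curl A x) y"
proof -
  have "(J - transpose J) *v y = cross3 (vector [J $ 3 $ 2 - J $ 2 $ 3, J $ 1 $ 3 - J $ 3 $ 1, J $ 2 $ 1 - J $ 1 $ 2]) y"
    for J :: "real^3^3"
    unfolding vec_eq_iff forall_3 cross3_def vector_3
    by (simp add: matrix_vector_mult_def sum_3 transpose_def left_diff_distrib)
  then show ?thesis by (simp add: curl_def Let_def)
qed

text \<open>
  Let \<open>J\<close> be the Jacobian of \<open>A\<close> at \<open>y\<close>. The derivative of \<open>A y \<bullet> S y\<close> in direction \<open>k\<close> is
  \<open>k \<bullet> (J\<^sup>T S y - S A y)\<close>. Here \<open>J\<^sup>T = J + S\<close> by the curl condition and \<open>J S y = S A y\<close> by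
  equivariance, which leaves \<open>k \<bullet> S S y\<close>, the derivative of \<open>- |S y|\<^sup>2 / 2\<close>.
\<close>
lemma potential_along_rotation:
  fixes S :: "real^3^3"
  assumes skew: "transpose S = - S" and cube: "S ** S ** S = - (\<beta>\<^sup>2) *\<^sub>R S" and \<beta>: "\<beta> \<noteq> 0"
    and pot: "vector_potential A B" and B: "\<And>x. B x = b" and SB: "\<And>v. S *v v = cross3 v b"
    and inv: "\<And>\<tau> x. mexp (- \<tau> *\<^sub>R S) *v A (mexp (\<tau> *\<^sub>R S) *v x) = A x"
  shows "A x \<bullet> (S *v x) = - (norm (S *v x))\<^sup>2 / 2"
proof -
  note sk = inner_skew_matrix[OF skew]
  define H where "H y = A y \<bullet> (S *v y) + (S *v y) \<bullet> (S *v y) / 2" for y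
  have "(H has_derivative (\<lambda>k. 0)) (at y)" for y
  proof -
    define J where "J = jacobian A (at y)"
    have dA: "(A has_derivative (\<lambda>k. J *v k)) (at y)"
      using pot jacobian_works[of A "at y"] by (simp add: vector_potential_def J_def)
    have eq: "J *v (S *v y) = S *v A y"
      by (rule equivariant_derivative[OF cube \<beta> dA inv])
    have "curl A y = b" using pot B by (simp add: vector_potential_def)
    then have "J *v z - transpose J *v z = - (S *v z)" for z
      using jacobian_curl[of A y z] cross_skew[of z b]
      unfolding matrix_vector_mult_diff_rdistrib by (simp add: J_def SB)
    then have "J *v (S *v y) - transpose J *v (S *v y) = - (S *v (S *v y))" .
    then have tJ: "transpose J *v (S *v y) = S *v A y + S *v (S *v y)"
      unfolding eq by (simp only: diff_eq_eq) simp
    have zero: "(J *v k) \<bullet> (S *v y) + A y \<bullet> (S *v k) + (S *v k) \<bullet> (S *v y) = 0" for k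
    proof -
      have "(J *v k) \<bullet> (S *v y) = k \<bullet> (transpose J *v (S *v y))"
        by (metis dot_lmul_matrix vector_transpose_matrix transpose_transpose)
      then show ?thesis unfolding tJ using sk[of "A y" k] sk[of k "S *v y"]
        by (simp add: inner_add_right inner_commute)
    qed
    show ?thesis unfolding H_def
      by (auto intro!: derivative_eq_intros dA bounded_linear.has_derivative[OF matrix_vector_mul_bounded_linear]
         simp: fun_eq_iff) (use zero in \<open>simp add: inner_commute add_ac\<close>)
  qed
  then obtain c where "\<And>y. H y = c"
    using has_derivative_zero_constant[of UNIV H] by auto
  then have "H x = H 0" by simp
  then show ?thesis by (simp add: H_def power2_norm_eq_inner)
qed

text \<open>
  Turns the averaged force of the implicit method into the force at a single point, where its
  tangentiality can be used.
\<close>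
lemma integral_affine_segment:
  fixes x y :: "'a::euclidean_space" and f :: "'a \<Rightarrow> 'b::euclidean_space"
  assumes f: "\<And>z. f z = L z + c" and L: "linear L"
  shows "integral {0..1} (\<lambda>\<rho>. f (\<rho> *\<^sub>R x + (1 - \<rho>) *\<^sub>R y)) = f ((1/2) *\<^sub>R (x + y))"
proof -
  have "((\<lambda>\<rho>::real. \<rho>) has_integral 1 / 2) {0..1}"
    using ident_has_integral[of 0 1] by simp
  then have "((\<lambda>\<rho>. \<rho> *\<^sub>R L (x - y) + (L y + c)) has_integral (1 / 2) *\<^sub>R L (x - y) + (L y + c)) {0..1}"
    using has_integral_const_real[of "L y + c" 0 1]
    by (intro has_integral_add[OF has_integral_scaleR_left]) simp_all
  moreover have "f (\<rho> *\<^sub>R x + (1 - \<rho>) *\<^sub>R y) = \<rho> *\<^sub>R L (x - y) + (L y + c)" for \<rho>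
    by (simp add: f linear_add[OF L] linear_diff[OF L] linear_scale[OF L] algebra_simps)
  moreover have "(1 / 2) *\<^sub>R L (x - y) + (L y + c) = f ((1/2) *\<^sub>R (x + y))"
    using scaleR_half_double[of "L y"]
    by (simp add: f linear_add[OF L] linear_diff[OF L] linear_scale[OF L] algebra_simps)
  ultimately show ?thesis by (simp add: integral_unique)
qed

section \<open>One step of the methods\<close>

text \<open>
  With \<open>a = v \<bullet> S x\<close>, \<open>d = S v \<bullet> S x\<close>, and \<open>c\<close>, \<open>s\<close> the cosine and sine of \<open>\<beta> t\<close>, undoing the
  rotations turns the balance \<open>u \<bullet> S x' = w \<bullet> S x\<close> into \<open>s (d + d') = \<beta> c (a' - a)\<close> and the sum
  on the left into \<open>c (d + d') + \<beta> s (a' - a)\<close>. Multiplying that sum by \<open>s\<close> eliminates \<open>d + d'\<close>, and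
  \<open>c\<^sup>2 + s\<^sup>2 = 1\<close> leaves the increment of \<open>a\<close> alone, so it can be summed over the steps.
\<close>
lemma rotated_step:
  fixes S :: "real^'n^'n"
  assumes skew: "transpose S = - S" and cube: "S ** S ** S = - (\<beta>\<^sup>2) *\<^sub>R S" and \<beta>: "\<beta> \<noteq> 0"
    and w: "w = mexp (t *\<^sub>R S) *v v" and v': "v' = mexp (t *\<^sub>R S) *v u"
    and bal: "u \<bullet> (S *v x') = w \<bullet> (S *v x)"
  shows "sin (\<beta> * t) * ((S *v w) \<bullet> (S *v x) + (S *v u) \<bullet> (S *v x')) = \<beta> * (v' \<bullet> (S *v x') - v \<bullet> (S *v x))"
proof -
  define c s where "c = cos (\<beta> * t)" and "s = sin (\<beta> * t)"
  define a a' d d' where "a = v \<bullet> (S *v x)" and "a' = v' \<bullet> (S *v x')"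
    and "d = (S *v v) \<bullet> (S *v x)" and "d' = (S *v v') \<bullet> (S *v x')"
  note sk = inner_skew_matrix[OF skew]
  have S3: "S *v (S *v (S *v y)) = - (\<beta>\<^sup>2) *\<^sub>R (S *v y)" for y
    by (rule cube_vec[OF cube])
  have SS: "(S *v (S *v y)) \<bullet> (S *v z) = - (\<beta>\<^sup>2) * (y \<bullet> (S *v z))" for y z
    by (simp add: sk S3)
  have SS0: "(S *v (S *v y)) \<bullet> z = - ((S *v y) \<bullet> (S *v z))" for y z
    by (simp add: sk)
  have Sw: "S *v w = c *\<^sub>R (S *v v) + (s / \<beta>) *\<^sub>R (S *v (S *v v))"
    unfolding c_def s_def w by (rule S_mult_mexp[OF cube \<beta>])
  have Su: "S *v u = c *\<^sub>R (S *v v') - (s / \<beta>) *\<^sub>R (S *v (S *v v'))"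
    unfolding c_def s_def by (rule S_mult_mexp_preimage[OF cube \<beta> v'])
  have "w \<bullet> (S *v x) = c * a + s / \<beta> * d"
    using sk[of w x] unfolding Sw inner_add_left inner_scaleR_left SS0 a_def d_def
    by (simp add: sk[of v x])
  moreover have "u \<bullet> (S *v x') = c * a' - s / \<beta> * d'"
    using sk[of u x'] unfolding Su inner_diff_left inner_scaleR_left SS0 a'_def d'_def
    by (simp add: sk[of v' x'])
  ultimately have "s / \<beta> * (d + d') = c * (a' - a)"
    using bal by (simp add: algebra_simps add_divide_distrib)
  then have e: "s * (d + d') = \<beta> * c * (a' - a)"
    using \<beta> by (simp add: field_simps)
  have W: "(S *v w) \<bullet> (S *v x) = c * d - \<beta> * s * a"
    unfolding Sw inner_add_left inner_scaleR_left SS a_def d_def using \<beta> by (simp add: power2_eq_square)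
  have U: "(S *v u) \<bullet> (S *v x') = c * d' + \<beta> * s * a'"
    unfolding Su inner_diff_left inner_scaleR_left SS a'_def d'_def using \<beta> by (simp add: power2_eq_square)
  have "s * ((S *v w) \<bullet> (S *v x) + (S *v u) \<bullet> (S *v x')) = c * (s * (d + d')) + \<beta> * s\<^sup>2 * (a' - a)"
    unfolding W U by (simp add: algebra_simps power2_eq_square)
  also have "\<dots> = \<beta> * (c\<^sup>2 + s\<^sup>2) * (a' - a)"
    unfolding e by (simp add: algebra_simps power2_eq_square)
  finally show ?thesis by (simp add: a_def a'_def c_def s_def)
qed

text \<open>
  As \<open>x' - x = h (w + u) / 2\<close>, the change of angular momentum is \<open>(u - w) \<bullet> S (x + x') / 2\<close>, and
  \<open>u - w = h F\<close>. In the method \<open>F\<close> is the force at the midpoint of \<open>x\<close> and \<open>x'\<close>, where it is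
  tangential; this is the orthogonality assumed here.
\<close>
lemma implicit_step_momentum:
  fixes S :: "real^'n^'n"
  assumes skew: "transpose S = - S" and F: "F \<bullet> (S *v (x + x')) = 0"
    and x': "x' = x + h *\<^sub>R w + (h\<^sup>2 / 2) *\<^sub>R F" and u: "u = w + h *\<^sub>R F"
  shows "u \<bullet> (S *v x') = w \<bullet> (S *v x)"
proof -
  have sk: "(S *v y) \<bullet> z = - (y \<bullet> (S *v z))" for y z by (rule inner_skew_matrix[OF skew])
  have zero: "y \<bullet> (S *v y) = 0" for y using sk[of y y] by (simp add: inner_commute)
  have swap: "w \<bullet> (S *v F) = - (F \<bullet> (S *v w))" using sk[of w F] by (simp add: inner_commute)
  have "2 * (F \<bullet> (S *v x)) + h * (F \<bullet> (S *v w)) = 0"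
    using F unfolding matrix_vector_right_distrib inner_add_right unfolding x'
    by (simp add: matrix_vector_right_distrib matrix_vector_mult_scaleR inner_add_right zero)
  then have "h * (2 * (F \<bullet> (S *v x)) + h * (F \<bullet> (S *v w))) = 0" by simp
  then show ?thesis unfolding x' u
    by (simp add: matrix_vector_right_distrib matrix_vector_mult_scaleR inner_add_right inner_add_left zero swap
       power2_eq_square algebra_simps)
qed

text \<open>
  A trapezoidal rule for \<open>|S x|\<^sup>2\<close> whose defect is a difference of values of \<open>|S w|\<^sup>2 / 4\<close>. Since the
  half rotations preserve \<open>|S v|\<close>, this difference telescopes over the steps.
\<close>
lemma implicit_step_norm:
  fixes S :: "real^'n^'n"
  assumes x': "x' = x + h *\<^sub>R w + (h\<^sup>2 / 2) *\<^sub>R F" and u: "u = w + h *\<^sub>R F"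
  shows "(norm (S *v x'))\<^sup>2 - (norm (S *v x))\<^sup>2 =
    h * ((S *v w) \<bullet> (S *v x) + (S *v u) \<bullet> (S *v x'))
    - h\<^sup>2 * ((norm (S *v u))\<^sup>2 / 4 - (norm (S *v w))\<^sup>2 / 4)"
  unfolding x' u power2_norm_eq_inner
  by (simp add: matrix_vector_right_distrib matrix_vector_mult_scaleR inner_add_right inner_add_left inner_commute
       power2_eq_square field_simps)

text \<open>
  Both half kicks are tangential and leave the angular momentum unchanged. The drift in between
  moves \<open>x\<close> along the velocity \<open>p\<close>, and \<open>p \<bullet> S p = 0\<close>.
\<close>
lemma explicit_step_momentum:
  fixes S :: "real^'n^'n"
  assumes skew: "transpose S = - S" and E: "E \<bullet> (S *v x) = 0" "E' \<bullet> (S *v x') = 0"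
    and x': "x' = x + h *\<^sub>R w + (h\<^sup>2 / 2) *\<^sub>R E" and u: "u = w + (h / 2) *\<^sub>R (E + E')"
  shows "u \<bullet> (S *v x') = w \<bullet> (S *v x)"
proof -
  \<comment> \<open>the velocity after the first half kick\<close>
  define p where "p = w + (h / 2) *\<^sub>R E"
  have p: "x' = x + h *\<^sub>R p" "u = p + (h / 2) *\<^sub>R E'"
    by (simp_all add: p_def x' u algebra_simps power2_eq_square)
  have "p \<bullet> (S *v p) = 0" using inner_skew_matrix[OF skew, of p p] by (simp add: inner_commute)
  then have "p \<bullet> (S *v x') = p \<bullet> (S *v x)"
    by (simp add: p matrix_vector_right_distrib matrix_vector_mult_scaleR inner_add_right)
  then have "u \<bullet> (S *v x') = p \<bullet> (S *v x)" using E by (simp add: p(2) inner_add_left)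
  then show ?thesis using E by (simp add: p_def inner_add_left)
qed

text \<open>
  The counterpart of \<open>implicit_step_norm\<close>; here the defect is a difference of values of
  \<open>S E(x) \<bullet> S x / 2\<close>.
\<close>
lemma explicit_step_norm:
  fixes S :: "real^'n^'n"
  assumes x': "x' = x + h *\<^sub>R w + (h\<^sup>2 / 2) *\<^sub>R E" and u: "u = w + (h / 2) *\<^sub>R (E + E')"
  shows "(norm (S *v x'))\<^sup>2 - (norm (S *v x))\<^sup>2 =
    h * ((S *v w) \<bullet> (S *v x) + (S *v u) \<bullet> (S *v x'))
    - h\<^sup>2 * ((S *v E') \<bullet> (S *v x') / 2 - (S *v E) \<bullet> (S *v x) / 2)"
proof -
  define p where "p = w + (h / 2) *\<^sub>R E"
  have p: "x' = x + h *\<^sub>R p" "u = p + (h / 2) *\<^sub>R E'" "w = p - (h / 2) *\<^sub>R E"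
    by (simp_all add: p_def x' u algebra_simps power2_eq_square)
  show ?thesis
    unfolding p(2,3) unfolding p(1) power2_norm_eq_inner
    by (simp add: matrix_vector_right_distrib matrix_vector_mult_diff_distrib
        matrix_vector_mult_scaleR inner_add_right inner_add_left inner_diff_left inner_commute power2_eq_square algebra_simps)
qed

section \<open>The conserved quantity and the drift of the momentum\<close>

text \<open>
  The sequence \<open>g\<close> abstracts from the method: the argument only needs that the defect in the
  norm balance is a difference of consecutive terms.
\<close>
lemma modified_momentum_conserved:
  fixes S :: "real^'n^'n" and x v :: "nat \<Rightarrow> real^'n" and g :: "nat \<Rightarrow> real"
  assumes skew: "transpose S = - S" and cube: "S ** S ** S = - (\<beta>\<^sup>2) *\<^sub>R S" and \<beta>: "\<beta> \<noteq> 0"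
    and step: "\<And>n. \<exists>w u. w = mexp ((h / 2) *\<^sub>R S) *v v n \<and> v (Suc n) = mexp ((h / 2) *\<^sub>R S) *v u \<and>
      u \<bullet> (S *v x (Suc n)) = w \<bullet> (S *v x n) \<and>
      (norm (S *v x (Suc n)))\<^sup>2 - (norm (S *v x n))\<^sup>2 =
        h * ((S *v w) \<bullet> (S *v x n) + (S *v u) \<bullet> (S *v x (Suc n))) - h\<^sup>2 * (g (Suc n) - g n)"
  shows "h * \<beta> * (v n \<bullet> (S *v x n) - v 0 \<bullet> (S *v x 0)) =
    sin (h * \<beta> / 2) * ((norm (S *v x n))\<^sup>2 - (norm (S *v x 0))\<^sup>2 + h\<^sup>2 * (g n - g 0))"
proof (induction n)
  case (Suc n)
  obtain w u where w: "w = mexp ((h / 2) *\<^sub>R S) *v v n" and u: "v (Suc n) = mexp ((h / 2) *\<^sub>R S) *v u"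
    and bal: "u \<bullet> (S *v x (Suc n)) = w \<bullet> (S *v x n)"
    and nrm: "(norm (S *v x (Suc n)))\<^sup>2 - (norm (S *v x n))\<^sup>2 =
        h * ((S *v w) \<bullet> (S *v x n) + (S *v u) \<bullet> (S *v x (Suc n))) - h\<^sup>2 * (g (Suc n) - g n)"
    using step by blast
  have "sin (h * \<beta> / 2) * ((norm (S *v x (Suc n)))\<^sup>2 - (norm (S *v x n))\<^sup>2 + h\<^sup>2 * (g (Suc n) - g n))
      = h * (sin (\<beta> * (h / 2)) * ((S *v w) \<bullet> (S *v x n) + (S *v u) \<bullet> (S *v x (Suc n))))"
    unfolding nrm by (simp add: mult_ac)
  also have "\<dots> = h * \<beta> * (v (Suc n) \<bullet> (S *v x (Suc n)) - v n \<bullet> (S *v x n))"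
    unfolding rotated_step[OF skew cube \<beta> w u bal] by simp
  finally show ?case using Suc by (simp add: algebra_simps)
qed simp

text \<open>
  An error bound relative to \<open>sin \<theta>\<close> is needed because the conserved quantity has to be divided
  by it. The cubic Taylor bound also yields \<open>\<theta> / 2 \<le> sin \<theta>\<close>, which converts the absolute
  error \<open>\<theta>\<^sup>3 / 6\<close>.
\<close>
lemma sin_relative_error:
  fixes \<theta> :: real
  assumes "0 < \<theta>" "\<theta> \<le> 1"
  shows "0 < sin \<theta>" "\<bar>sin \<theta> - \<theta>\<bar> \<le> \<theta>\<^sup>2 / 3 * sin \<theta>"
proof -
  have *: "\<bar>sin \<theta> - \<theta>\<bar> \<le> \<theta>\<^sup>2 / 6 * \<theta>"
    using Maclaurin_sin_bound[of \<theta> 3] assms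
    by (simp add: eval_nat_numeral sin_coeff_def field_simps)
  have "\<theta>\<^sup>2 \<le> 1" using assms by (simp add: power_le_one)
  then have "\<theta>\<^sup>2 / 6 * \<theta> \<le> 1 / 2 * \<theta>" using assms by (intro mult_right_mono) auto
  then have half: "\<theta> / 2 \<le> sin \<theta>" using * by linarith
  then show "0 < sin \<theta>" using assms by linarith
  have "\<theta>\<^sup>2 / 6 * \<theta> \<le> \<theta>\<^sup>2 / 3 * sin \<theta>"
    using mult_left_mono[OF half, of "\<theta>\<^sup>2 / 3"] by simp
  with * show "\<bar>sin \<theta> - \<theta>\<bar> \<le> \<theta>\<^sup>2 / 3 * sin \<theta>" by linarith
qed

text \<open>
  Here \<open>a\<close>, \<open>X\<close>, \<open>g\<close> stand for \<open>v \<bullet> S x\<close>, \<open>|S x|\<^sup>2\<close> and the correction \<open>g\<close> at the start, and the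
  primed letters for the values after any number of steps. Conservation replaces the change of
  \<open>sin \<theta> X / 2\<close> by that of \<open>\<theta> a - sin \<theta> h\<^sup>2 g / 2\<close>, so what remains of the momentum change
  carries a factor \<open>sin \<theta> - \<theta>\<close> or \<open>h\<^sup>2\<close>.
\<close>
lemma momentum_drift_bound:
  fixes h \<beta> :: real
  assumes h: "0 < h" "h * \<beta> / 2 \<le> 1" and \<beta>: "0 < \<beta>"
    and cons: "h * \<beta> * (a' - a) = sin (h * \<beta> / 2) * (X' - X + h\<^sup>2 * (g' - g))"
    and bnd: "\<bar>a\<bar> \<le> G" "\<bar>a'\<bar> \<le> G" "\<bar>g\<bar> \<le> G" "\<bar>g'\<bar> \<le> G"
  shows "\<bar>(a' - X' / 2) - (a - X / 2)\<bar> \<le> (\<beta>\<^sup>2 / 6 + 1) * G * h\<^sup>2"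
proof -
  define \<theta> s where "\<theta> = h * \<beta> / 2" and "s = sin \<theta>"
  have \<theta>: "0 < \<theta>" "\<theta> \<le> 1" using h \<beta> by (simp_all add: \<theta>_def)
  have s: "0 < s" "\<bar>s - \<theta>\<bar> \<le> \<theta>\<^sup>2 / 3 * s" using sin_relative_error[OF \<theta>] by (simp_all add: s_def)
  have "s * ((a' - X' / 2) - (a - X / 2)) = (s - \<theta>) * (a' - a) + s * (h\<^sup>2 / 2) * (g' - g)"
  proof -
    have "2 * \<theta> * (a' - a) = s * (X' - X + h\<^sup>2 * (g' - g))"
      using cons by (simp add: s_def \<theta>_def)
    then show ?thesis by (simp add: field_simps)
  qed
  then have "s * \<bar>(a' - X' / 2) - (a - X / 2)\<bar> = \<bar>(s - \<theta>) * (a' - a) + s * (h\<^sup>2 / 2) * (g' - g)\<bar>"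
    using s(1) by (metis abs_mult abs_of_pos)
  also have "\<dots> \<le> \<bar>s - \<theta>\<bar> * \<bar>a' - a\<bar> + s * (h\<^sup>2 / 2) * \<bar>g' - g\<bar>"
    using s(1) abs_triangle_ineq[of "(s - \<theta>) * (a' - a)" "s * (h\<^sup>2 / 2) * (g' - g)"] by (simp add: abs_mult)
  also have "\<dots> \<le> (\<theta>\<^sup>2 / 3 * s) * (2 * G) + s * (h\<^sup>2 / 2) * (2 * G)"
    using bnd s by (intro add_mono mult_mono mult_left_mono) auto
  also have "\<dots> = s * ((\<beta>\<^sup>2 / 6 + 1) * G * h\<^sup>2)"
    by (simp add: \<theta>_def power_divide power_mult_distrib algebra_simps)
  finally show ?thesis using s(1) by simp
qed

theorem theorem3p2:
  fixes S Q :: "real^3^3" and b q x0 v0 :: "real^3"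
    and U :: "real^3 \<Rightarrow> real" and A B :: "real^3 \<Rightarrow> real^3"
    and K :: "((real^3) \<times> (real^3)) set" and N :: nat
  assumes S_skew: "transpose S = - S"
    and potential: "vector_potential A B"
    and U_inv: "\<And>\<tau> x. U (mexp (\<tau> *\<^sub>R S) *v x) = U x"
    and A_inv: "\<And>\<tau> x. mexp (- \<tau> *\<^sub>R S) *v A (mexp (\<tau> *\<^sub>R S) *v x) = A x"
    and B_const: "\<And>x. B x = b"
    and S_B: "\<And>v. S *v v = cross3 v b"
    and U_quad: "\<And>x. U x = 1 / 2 * (x \<bullet> (Q *v x)) + q \<bullet> x"
    and Q_sym: "transpose Q = Q"
    and QS: "Q ** S = S ** Q"
    and K: "compact K"
    and N: "N \<ge> 1"
  shows "\<exists>C. \<exists>h0>0. \<forall>h. 0 < h \<and> h < h0 \<longrightarrow>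
    (\<forall>x v. (ims_o2 B U h x0 v0 x v \<or> exs_o2 B U h x0 v0 x v) \<and> (\<forall>n. (x n, v n) \<in> K) \<longrightarrow>
      (\<forall>n. real n * h \<le> h powi (2 - int N) \<longrightarrow>
        \<bar>momentum S A (x n) (v n) - momentum S A (x 0) (v 0)\<bar> \<le> C * h\<^sup>2))"
proof (cases "b = 0")
  case True
  \<comment> \<open>Without a magnetic field \<open>S = 0\<close>; the Rodrigues formula, which divides by \<open>\<beta>\<close>, does not apply.\<close>
  then have "momentum S A y z = 0" for y z
    by (simp add: momentum_def S_B)
  then show ?thesis by (intro exI[of _ 0] exI[of _ 1]) simp
next
  case False
  define \<beta> where "\<beta> = norm b"
  have \<beta>: "0 < \<beta>" "\<beta> \<noteq> 0" using False by (simp_all add: \<beta>_def)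
  have "cross3 (cross3 (cross3 y b) b) b = - (b \<bullet> b) *\<^sub>R cross3 y b" for y
    by (simp add: cross3_simps)
  then have cube: "S ** S ** S = - (\<beta>\<^sup>2) *\<^sub>R S"
    unfolding matrix_eq \<beta>_def power2_norm_eq_inner
    by (simp only: S_B flip: matrix_vector_mul_assoc scaleR_matrix_vector_assoc) blast
  have Bt: "Btilde B y = S" for y
    by (simp add: Btilde_def B_const flip: S_B)
  have E: "efield U y = (- Q) *v y + (- q)" for y
    using scaleR_matrix_vector_assoc[of "-1" Q y]
    by (simp add: efield_def grad_quadratic[OF Q_sym U_quad])
  have ES: "efield U y \<bullet> (S *v y) = 0" for y
    using invariant_quadratic_force_tangential[OF S_skew cube \<beta>(2) U_inv U_quad Q_sym QS]
    by (simp add: efield_def)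
  have mom: "momentum S A y z = z \<bullet> (S *v y) - (norm (S *v y))\<^sup>2 / 2" for y z
    using potential_along_rotation[OF S_skew cube \<beta>(2) potential B_const S_B A_inv]
    by (simp add: momentum_def inner_add_left)
  \<comment> \<open>One continuous function dominates the angular momentum and the corrections of both methods.\<close>
  define \<Phi> where "\<Phi> = (\<lambda>(y, z). \<bar>z \<bullet> (S *v y)\<bar> + \<bar>(norm (S *v z))\<^sup>2 / 4\<bar> + \<bar>(S *v efield U y) \<bullet> (S *v y) / 2\<bar>)"
  have "continuous_on K \<Phi>"
    unfolding \<Phi>_def E case_prod_unfold
    by (intro continuous_intros bounded_linear.continuous_on[OF matrix_vector_mul_bounded_linear]) auto
  then have "bounded (\<Phi> ` K)"
    using K compact_continuous_image compact_imp_bounded by blast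
  then obtain G where G: "\<And>p. p \<in> K \<Longrightarrow> \<bar>\<Phi> p\<bar> \<le> G"
    unfolding bounded_iff by auto
  have bnd: "\<bar>z \<bullet> (S *v y)\<bar> \<le> G" "\<bar>(norm (S *v z))\<^sup>2 / 4\<bar> \<le> G" "\<bar>(S *v efield U y) \<bullet> (S *v y) / 2\<bar> \<le> G"
    if "(y, z) \<in> K" for y z
  proof -
    have "\<Phi> (y, z) \<le> G" using G[OF that] by linarith
    then show "\<bar>z \<bullet> (S *v y)\<bar> \<le> G" "\<bar>(norm (S *v z))\<^sup>2 / 4\<bar> \<le> G"
      "\<bar>(S *v efield U y) \<bullet> (S *v y) / 2\<bar> \<le> G"
      unfolding \<Phi>_def prod.case by linarith+
  qed
  \<comment> \<open>The bound \<open>h < 1 / \<beta>\<close> keeps \<open>\<theta> = h \<beta> / 2\<close> below 1, where \<open>sin \<theta>\<close> is positive.\<close>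
  show ?thesis
  proof (rule exI[of _ "(\<beta>\<^sup>2 / 6 + 1) * G"], rule exI[of _ "1 / \<beta>"], intro conjI allI impI)
    show "0 < 1 / \<beta>" using \<beta> by simp
  next
    fix h x v n
    assume h: "0 < h \<and> h < 1 / \<beta>"
      and xv: "(ims_o2 B U h x0 v0 x v \<or> exs_o2 B U h x0 v0 x v) \<and> (\<forall>n. (x n, v n) \<in> K)"
    have h1: "0 < h" "h * \<beta> / 2 \<le> 1" using h \<beta> by (auto simp: field_simps)
    define R where "R = mexp ((h / 2) *\<^sub>R S)"
    have inK: "(x n, v n) \<in> K" for n using xv by blast
    note cons = modified_momentum_conserved[OF S_skew cube \<beta>(2), of h v x _ n, folded R_def]
    note drift = momentum_drift_bound[OF h1 \<beta>(1)]
    show "\<bar>momentum S A (x n) (v n) - momentum S A (x 0) (v 0)\<bar> \<le> (\<beta>\<^sup>2 / 6 + 1) * G * h\<^sup>2"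
      unfolding mom
    proof (rule disjE[OF conjunct1[OF xv]])
      assume m: "ims_o2 B U h x0 v0 x v"
      show "\<bar>v n \<bullet> (S *v x n) - (norm (S *v x n))\<^sup>2 / 2 - (v 0 \<bullet> (S *v x 0) - (norm (S *v x 0))\<^sup>2 / 2)\<bar>
          \<le> (\<beta>\<^sup>2 / 6 + 1) * G * h\<^sup>2"
      proof (rule drift[OF cons[where g = "\<lambda>n. (norm (S *v v n))\<^sup>2 / 4"]])
        fix n
        define F where "F = efield U ((1/2) *\<^sub>R (x n + x (Suc n)))"
        define w where "w = R *v v n"
        define u where "u = w + h *\<^sub>R F"
        have "integral {0..1} (\<lambda>\<rho>. efield U (\<rho> *\<^sub>R x n + (1 - \<rho>) *\<^sub>R x (Suc n))) = F"
          unfolding F_def by (rule integral_affine_segment[OF E matrix_vector_mul_linear])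
        note F_eq = this[symmetric]
        have x: "x (Suc n) = x n + h *\<^sub>R w + (h\<^sup>2 / 2) *\<^sub>R F"
          using m unfolding ims_o2_def Let_def Bt F_eq w_def R_def by blast
        have v: "v (Suc n) = R *v u"
          using m unfolding ims_o2_def Let_def Bt F_eq u_def w_def R_def
            matrix_vector_right_distrib matrix_vector_mult_scaleR by blast
        have "F \<bullet> (S *v (x n + x (Suc n))) = 0"
          using ES[of "(1/2) *\<^sub>R (x n + x (Suc n))"] unfolding F_def[symmetric] matrix_vector_mult_scaleR by simp
        then have "u \<bullet> (S *v x (Suc n)) = w \<bullet> (S *v x n)"
          by (rule implicit_step_momentum[OF S_skew _ x u_def])
        moreover have "norm (S *v u) = norm (S *v v (Suc n))" "norm (S *v w) = norm (S *v v n)"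
          unfolding v w_def R_def by (simp_all only: norm_S_mult_mexp[OF S_skew cube \<beta>(2)])
        ultimately show "\<exists>w u. w = R *v v n \<and> v (Suc n) = R *v u \<and>
            u \<bullet> (S *v x (Suc n)) = w \<bullet> (S *v x n) \<and>
            (norm (S *v x (Suc n)))\<^sup>2 - (norm (S *v x n))\<^sup>2 =
            h * ((S *v w) \<bullet> (S *v x n) + (S *v u) \<bullet> (S *v x (Suc n)))
            - h\<^sup>2 * ((norm (S *v v (Suc n)))\<^sup>2 / 4 - (norm (S *v v n))\<^sup>2 / 4)"
          using implicit_step_norm[OF x u_def, of S] v w_def by (intro exI[of _ w] exI[of _ u]) simp
      qed (use bnd inK in blast)+
    next
      assume m: "exs_o2 B U h x0 v0 x v"
      show "\<bar>v n \<bullet> (S *v x n) - (norm (S *v x n))\<^sup>2 / 2 - (v 0 \<bullet> (S *v x 0) - (norm (S *v x 0))\<^sup>2 / 2)\<bar>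
          \<le> (\<beta>\<^sup>2 / 6 + 1) * G * h\<^sup>2"
      proof (rule drift[OF cons[where g = "\<lambda>n. (S *v efield U (x n)) \<bullet> (S *v x n) / 2"]])
        fix n
        define w where "w = R *v v n"
        define u where "u = w + (h / 2) *\<^sub>R (efield U (x n) + efield U (x (Suc n)))"
        have x: "x (Suc n) = x n + h *\<^sub>R w + (h\<^sup>2 / 2) *\<^sub>R efield U (x n)"
          and v: "v (Suc n) = R *v u"
          using m by (simp_all add: exs_o2_def Let_def Bt R_def w_def u_def matrix_vector_right_distrib matrix_vector_mult_scaleR)
        show "\<exists>w u. w = R *v v n \<and> v (Suc n) = R *v u \<and>
            u \<bullet> (S *v x (Suc n)) = w \<bullet> (S *v x n) \<and>
            (norm (S *v x (Suc n)))\<^sup>2 - (norm (S *v x n))\<^sup>2 =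
            h * ((S *v w) \<bullet> (S *v x n) + (S *v u) \<bullet> (S *v x (Suc n)))
            - h\<^sup>2 * ((S *v efield U (x (Suc n))) \<bullet> (S *v x (Suc n)) / 2 - (S *v efield U (x n)) \<bullet> (S *v x n) / 2)"
          using explicit_step_momentum[OF S_skew ES ES x u_def] explicit_step_norm[OF x u_def, of S] v w_def
          by blast
      qed (use bnd inK in blast)+
    qed
  qed
qed

end
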